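(* Let $M\ge1$, and $a_1,\dots,a_M\in[0,1]$ with $\sum_i a_i=1$. For each $k\in\{1,\dots,M\}$ let $V_k:\mathbb{R}\to\mathbb{R}$ be an even polynomial $$V_k(x)=-\frac{\theta_k^{(2)}}2x^2+\sum_{\ell=2}^{p_k}\frac{\theta_k^{(2\ell)}}{2\ell}x^{2\ell},\qquad p_k\ge2,\ \theta_k^{(2)}>0,\ \theta_k^{(2p_k)}>0,\ \theta_k^{(2i)}\ge0\text{ for }2\le i\le p_k-1.$$ Let $\alpha_{k\ell}\ge0$ for all $1\le k,\ell\le M$ and $\alpha_{kk}>0$ for all $k$, and let the interaction potentials be $F_{k\ell}(x)=\frac{\alpha_{k\ell}}2x^2$. Then there exists $\sigma_0>0$ such that for any $\sigma=(\sigma_1,\dots,\sigma_M)\in(0,\infty)^M$ with $\min_{1\le k\le M}\sigma_k\ge\sigma_0$, the unique solution $(m_1,\dots,m_M)\in\mathbb{R}^M$ of the system $$m_k=\frac{\int_{\mathbb{R}} x\exp\Big[-\frac{2}{\sigma_k^2}\Big(V_k(x)+\frac12\sum_{\ell=1}^M a_\ell\alpha_{k\ell}x^2-x\sum_{\ell=1}^M a_\ell\alpha_{k\ell}m_\ell\Big)\Big]dx}{\int_{\mathbb{R}} \exp\Big[-\frac{2}{\sigma_k^2}\Big(V_k(x)+\frac12\sum_{\ell=1}^M a_\ell\alpha_{k\ell}x^2-x\sum_{\ell=1}^M a_\ell\alpha_{k\ell}m_\ell\Big)\Big]dx},\qquad k=1,\dots,M,$$ is $m_k=0$ for every $1\le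 k\le M$. Consequently, the associated multi-species McKean-Vlasov diffusion admits a unique stationary state, and the means of all its components are zero.
   Context: The multi-species McKean-Vlasov diffusion is $dX^k_t=-V_k'(X^k_t)dt-\sum_{\ell=1}^M a_\ell (F_{k\ell}'*\mu^\ell_t)(X^k_t)dt+\sigma_k dW^k_t$, $k=1,\dots,M$, where $\mu^\ell_t$ is the law of $X^\ell_t$ and the $W^k$ are independent Brownian motions. A stationary state is an $M$-tuple $(\mu^1,\dots,\mu^M)$ of probability measures on $\mathbb{R}$ with densities satisfying $\mu^k(x)=Z_k^{-1}\exp[-\frac{2}{\sigma_k^2}(V_k(x)+\sum_{\ell} a_\ell F_{k\ell}*\mu^\ell(x))]$ with normalization constants $Z_k$; its mean vector is $m_k=\int x\mu^k(x)dx$. *)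

theory Defs
  imports "HOL-Probability.Probability"
begin

text \<open>The species are indexed by a finite type \<open>'m\<close>, with \<open>M = CARD('m) \<ge> 1\<close>. The coefficient
  \<open>\<theta>\<^sup>(\<^sup>j\<^sup>)\<close> of a potential is \<open>\<theta> j\<close>; only the even indices \<open>2, 4, ..., 2 * p\<close> are used.\<close>

definition even_potential :: "nat \<Rightarrow> (nat \<Rightarrow> real) \<Rightarrow> real \<Rightarrow> real" where
  "even_potential p \<theta> x =
     - (\<theta> 2 / 2) * x ^ 2 + (\<Sum>l = 2..p. \<theta> (2 * l) / real (2 * l) * x ^ (2 * l))"

definition quadratic_interaction :: "real \<Rightarrow> real \<Rightarrow> real" where
  "quadratic_interaction \<alpha> x = \<alpha> / 2 * x ^ 2"

definition conv :: "(real \<Rightarrow> real) \<Rightarrow> real measure \<Rightarrow> real \<Rightarrow> real" where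
  "conv f \<mu> x = (\<integral>y. f (x - y) \<partial>\<mu>)"

text \<open>The integrability clause says that all convolutions \<open>F k l * \<mu> l\<close> are well defined; it cannot
  be dropped, because the Bochner integral of a non-integrable function is \<open>0\<close>. The two last
  clauses say that \<open>\<mu> k\<close> has the prescribed Lebesgue density, and together with
  \<open>prob_space (\<mu> k)\<close> they determine the normalization constant \<open>Z\<close>.\<close>

definition stationary_state ::
  "('m::finite \<Rightarrow> real \<Rightarrow> real) \<Rightarrow> ('m \<Rightarrow> 'm \<Rightarrow> real \<Rightarrow> real) \<Rightarrow> real ^ 'm \<Rightarrow> real ^ 'm \<Rightarrow>
   ('m \<Rightarrow> real measure) \<Rightarrow> bool" where
  "stationary_state V F a \<sigma> \<mu> \<longleftrightarrow>
     (\<forall>k. prob_space (\<mu> k)) \<and>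
     (\<forall>k l x. integrable (\<mu> l) (\<lambda>y. F k l (x - y))) \<and>
     (\<forall>k. \<exists>Z>0. \<mu> k = density lborel (\<lambda>x. ennreal
        (1 / Z * exp (- (2 / (\<sigma> $ k) ^ 2) *
           (V k x + (\<Sum>l\<in>UNIV. a $ l * conv (F k l) (\<mu> l) x))))))"

definition self_consistency_weight ::
  "('m::finite \<Rightarrow> real \<Rightarrow> real) \<Rightarrow> real ^ 'm ^ 'm \<Rightarrow> real ^ 'm \<Rightarrow> real ^ 'm \<Rightarrow> real ^ 'm \<Rightarrow>
   'm \<Rightarrow> real \<Rightarrow> real" where
  "self_consistency_weight V \<alpha> a \<sigma> m k x =
     exp (- (2 / (\<sigma> $ k) ^ 2) *
       (V k x + 1 / 2 * (\<Sum>l\<in>UNIV. a $ l * \<alpha> $ k $ l * x ^ 2)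
        - x * (\<Sum>l\<in>UNIV. a $ l * \<alpha> $ k $ l * m $ l)))"

definition self_consistent ::
  "('m::finite \<Rightarrow> real \<Rightarrow> real) \<Rightarrow> real ^ 'm ^ 'm \<Rightarrow> real ^ 'm \<Rightarrow> real ^ 'm \<Rightarrow> real ^ 'm \<Rightarrow> bool"
  where
  "self_consistent V \<alpha> a \<sigma> m \<longleftrightarrow>
     (\<forall>k. m $ k =
        (\<integral>x. x * self_consistency_weight V \<alpha> a \<sigma> m k x \<partial>lborel) /
        (\<integral>x. self_consistency_weight V \<alpha> a \<sigma> m k x \<partial>lborel))"

end

theory Submission
  imports Defs
begin

text \<open>With \<open>\<epsilon> = 2 / \<sigma>\<^sup>2\<close>, \<open>b = \<Sum>l. a l * \<alpha> k l\<close> and \<open>c = \<Sum>l. a l * \<alpha> k l * m l\<close>, equation \<open>k\<close> says that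
  \<open>m k\<close> is the mean of the Gibbs measure with weight \<open>exp (- \<epsilon> * (V x + b / 2 * x\<^sup>2 - c * x))\<close>, and
  integration by parts gives \<open>b * m k = c - E[V']\<close>. For \<open>c > 0\<close> one has \<open>E[V'] > 0\<close> at large noise:
  symmetrizing replaces the tilt by \<open>sinh (\<epsilon> * c * x)\<close>; since \<open>V' x / x\<close> changes sign only once on the
  half line and \<open>sinh (\<epsilon> * c * x) / x\<close> is increasing there, it is enough that \<open>x * V' x\<close> has positive
  mean for \<open>c = 0\<close>, which is clear as \<open>\<epsilon> \<rightarrow> 0\<close>. Hence \<open>b * \<bar>m k\<bar> < \<bar>c\<bar>\<close> whenever \<open>c \<noteq> 0\<close>. At an index
  \<open>k\<close> maximizing \<open>\<bar>m k\<bar>\<close> also \<open>\<bar>c\<bar> \<le> b * \<bar>m k\<bar>\<close>, so \<open>m = 0\<close>. Finally, a stationary state is the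
  family of Gibbs measures determined by its mean vector, which is self-consistent.\<close>

section \<open>Gibbs weights of superquadratic potentials: domination and integrability\<close>

text \<open>Quantifying over every \<open>K\<close> makes the growth condition independent of the
  temperature: for any \<open>\<epsilon> > 0\<close>, enough quadratic growth remains to absorb a
  linear tilt and leave a Gaussian.\<close>

definition superquadratic :: "(real \<Rightarrow> real) \<Rightarrow> bool" where
  "superquadratic U \<longleftrightarrow> (\<forall>K. \<exists>C. \<forall>x. K * x\<^sup>2 \<le> U x + C)"

text \<open>The unnormalized Gibbs density at inverse temperature \<open>\<epsilon>\<close> in a
  constant external field \<open>c\<close>.\<close>

definition gibbs_weight :: "(real \<Rightarrow> real) \<Rightarrow> real \<Rightarrow> real \<Rightarrow> real \<Rightarrow> real" where
  "gibbs_weight U \<epsilon> c x = exp (- \<epsilon> * (U x - c * x))"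

lemma superquadratic_add_square:
  assumes "superquadratic U" "b \<ge> 0"
  shows "superquadratic (\<lambda>x. U x + b * x\<^sup>2)"
  unfolding superquadratic_def
proof
  fix K
  obtain C where C: "\<And>x. K * x\<^sup>2 \<le> U x + C"
    using assms(1) unfolding superquadratic_def by blast
  have "K * x\<^sup>2 \<le> U x + b * x\<^sup>2 + C" for x
    using C[of x] mult_nonneg_nonneg[OF assms(2) zero_le_power2[of x]] by linarith
  then show "\<exists>C. \<forall>x. K * x\<^sup>2 \<le> U x + b * x\<^sup>2 + C" by blast
qed

lemma gibbs_weight_pos: "gibbs_weight U \<epsilon> c x > 0"
  by (simp add: gibbs_weight_def)

lemma gibbs_weight_gaussian_bound:
  assumes "superquadratic U" "\<epsilon> > 0"
  obtains D where "D > 0" "\<And>x. gibbs_weight U \<epsilon> c x \<le> D * exp (- x\<^sup>2 / 2)"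
proof -
  \<comment> \<open>Here \<open>1\<close> pays for the tilt through
    \<open>c * x \<le> x\<^sup>2 + c\<^sup>2\<close>, and \<open>1 / (2 * \<epsilon>)\<close>
    becomes the Gaussian exponent after multiplication by \<open>\<epsilon>\<close>.\<close>
  obtain C where C: "\<And>x. (1 + 1 / (2 * \<epsilon>)) * x\<^sup>2 \<le> U x + C"
    using assms(1) unfolding superquadratic_def by blast
  have "gibbs_weight U \<epsilon> c x \<le> exp (\<epsilon> * (C + c\<^sup>2)) * exp (- x\<^sup>2 / 2)" for x
  proof -
    have "c * x \<le> x\<^sup>2 + c\<^sup>2"
      using zero_le_power2[of "x - c"] zero_le_power2[of "x + c"]
      by (simp add: power2_eq_square algebra_simps)
    then have "x\<^sup>2 / (2 * \<epsilon>) - (C + c\<^sup>2) \<le> U x - c * x"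
      using C[of x] by (simp add: algebra_simps)
    then have "\<epsilon> * (x\<^sup>2 / (2 * \<epsilon>) - (C + c\<^sup>2)) \<le> \<epsilon> * (U x - c * x)"
      using assms(2) by (intro mult_left_mono) auto
    moreover have "\<epsilon> * (x\<^sup>2 / (2 * \<epsilon>) - (C + c\<^sup>2)) = x\<^sup>2 / 2 - \<epsilon> * (C + c\<^sup>2)"
      using assms(2) by (simp add: field_simps)
    ultimately show ?thesis
      by (simp add: gibbs_weight_def flip: exp_add)
  qed
  then show ?thesis by (intro that[of "exp (\<epsilon> * (C + c\<^sup>2))"]) auto
qed

text \<open>The Gaussian bound compares the integrand with the absolute moments of the standard
  normal density.\<close>

lemma integrable_power_gibbs_weight:
  assumes U: "superquadratic U" "continuous_on UNIV U" and \<epsilon>: "\<epsilon> > 0"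
  shows "integrable lborel (\<lambda>x. x ^ n * gibbs_weight U \<epsilon> c x)"
proof -
  have [measurable]: "U \<in> borel_measurable borel"
    using U(2) by (rule borel_measurable_continuous_onI)
  obtain D where D: "D > 0" "\<And>x. gibbs_weight U \<epsilon> c x \<le> D * exp (- x\<^sup>2 / 2)"
    using gibbs_weight_gaussian_bound[OF U(1) \<epsilon>] by blast
  have "integrable lborel (\<lambda>x. (D * sqrt (2 * pi)) * (std_normal_density x * \<bar>x\<bar> ^ n))"
    by (intro integrable_mult_right integrable_std_normal_moment_abs)
  then show ?thesis
  proof (rule Bochner_Integration.integrable_bound)
    show "(\<lambda>x. x ^ n * gibbs_weight U \<epsilon> c x) \<in> borel_measurable lborel"
      unfolding gibbs_weight_def by measurable
    show "AE x in lborel. norm (x ^ n * gibbs_weight U \<epsilon> c x)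
            \<le> norm ((D * sqrt (2 * pi)) * (std_normal_density x * \<bar>x\<bar> ^ n))"
    proof (rule AE_I2)
      fix x :: real
      have "\<bar>x\<bar> ^ n * gibbs_weight U \<epsilon> c x \<le> \<bar>x\<bar> ^ n * (D * exp (- x\<^sup>2 / 2))"
        by (intro mult_left_mono D) auto
      also have "\<dots> = (D * sqrt (2 * pi)) * (std_normal_density x * \<bar>x\<bar> ^ n)"
        by (simp add: std_normal_density_def)
      finally show "norm (x ^ n * gibbs_weight U \<epsilon> c x)
            \<le> norm ((D * sqrt (2 * pi)) * (std_normal_density x * \<bar>x\<bar> ^ n))"
        using D(1) gibbs_weight_pos[of U \<epsilon> c x]
        by (simp add: abs_mult power_abs less_imp_le)
    qed
  qed
qed

lemma integrable_gibbs_weight: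
  assumes "superquadratic U" "continuous_on UNIV U" "\<epsilon> > 0"
  shows "integrable lborel (gibbs_weight U \<epsilon> c)"
  using integrable_power_gibbs_weight[OF assms, of 0 c] by simp

lemma integral_gibbs_weight_pos:
  assumes "superquadratic U" "continuous_on UNIV U" "\<epsilon> > 0"
  shows "(\<integral>x. gibbs_weight U \<epsilon> c x \<partial>lborel) > 0"
proof -
  have nn: "AE x in lborel. 0 \<le> gibbs_weight U \<epsilon> c x"
    using gibbs_weight_pos[of U \<epsilon> c] by (simp add: less_imp_le)
  have "(\<integral>x. gibbs_weight U \<epsilon> c x \<partial>lborel) \<noteq> 0"
  proof
    assume "(\<integral>x. gibbs_weight U \<epsilon> c x \<partial>lborel) = 0"
    then have "AE x in lborel. gibbs_weight U \<epsilon> c x = 0"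
      using integral_nonneg_eq_0_iff_AE[OF integrable_gibbs_weight[OF assms] nn] by simp
    then have "AE x in lborel :: real measure. False"
      by eventually_elim (use gibbs_weight_pos[of U \<epsilon> c] in \<open>auto simp: less_le\<close>)
    then show False by (simp add: trivial_limit_def[symmetric] ae_filter_eq_bot_iff)
  qed
  moreover have "(\<integral>x. gibbs_weight U \<epsilon> c x \<partial>lborel) \<ge> 0"
    using nn by (rule integral_nonneg_AE)
  ultimately show ?thesis by simp
qed

text \<open>Removes the boundary terms when the derivative of the weight is integrated over the
  line.\<close>

lemma gibbs_weight_tendsto_0:
  assumes U: "superquadratic U" and \<epsilon>: "\<epsilon> > 0"
  shows "(gibbs_weight U \<epsilon> c \<longlongrightarrow> 0) at_top" "(gibbs_weight U \<epsilon> c \<longlongrightarrow> 0) at_bot"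
proof -
  obtain D where D: "D > 0" "\<And>x. gibbs_weight U \<epsilon> c x \<le> D * exp (- x\<^sup>2 / 2)"
    using gibbs_weight_gaussian_bound[OF U \<epsilon>] by blast
  have "((\<lambda>x::real. D * exp (- x\<^sup>2 / 2)) \<longlongrightarrow> 0) at_top"
    "((\<lambda>x::real. D * exp (- x\<^sup>2 / 2)) \<longlongrightarrow> 0) at_bot"
    by real_asymp+
  moreover have "(gibbs_weight U \<epsilon> c \<longlongrightarrow> 0) F"
    if "((\<lambda>x. D * exp (- x\<^sup>2 / 2)) \<longlongrightarrow> 0) F" for F
    by (rule tendsto_sandwich[OF _ _ tendsto_const that])
      (simp_all only: D less_imp_le[OF gibbs_weight_pos] eventually_True)
  ultimately show "(gibbs_weight U \<epsilon> c \<longlongrightarrow> 0) at_top" "(gibbs_weight U \<epsilon> c \<longlongrightarrow> 0) at_bot"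
    by blast+
qed

section \<open>Integration by parts on the real line\<close>

lemma integral_derivative_eq_0:
  fixes f F :: "real \<Rightarrow> real"
  assumes F: "\<And>x. (F has_real_derivative f x) (at x)" and f: "continuous_on UNIV f"
    and int: "integrable lborel f" and lim: "(F \<longlongrightarrow> 0) at_top" "(F \<longlongrightarrow> 0) at_bot"
  shows "(\<integral>x. f x \<partial>lborel) = 0"
proof -
  have "(LBINT x=-\<infinity>..\<infinity>. f x) = 0 - 0"
  proof (rule interval_integral_FTC_integrable)
    show "(F has_vector_derivative f x) (at x)" for x
      using F has_real_derivative_iff_has_vector_derivative by blast
    show "isCont f x" for x
      using f by (simp add: continuous_on_eq_continuous_at)
    show "set_integrable lborel (einterval (-\<infinity>) \<infinity>) f"
      using int by (simp add: set_integrable_def)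
    show "((F \<circ> real_of_ereal) \<longlongrightarrow> 0) (at_right (-\<infinity>))"
      "((F \<circ> real_of_ereal) \<longlongrightarrow> 0) (at_left \<infinity>)"
      using lim by (simp_all add: ereal_tendsto_simps)
  qed simp
  then show ?thesis
    by (simp add: interval_lebesgue_integral_def set_lebesgue_integral_def)
qed

text \<open>The derivative of the weight is \<open>- \<epsilon> * (U' x - c)\<close> times the
  weight, and its integral over the line is zero; the nonzero factor \<open>\<epsilon>\<close>
  cancels.\<close>

lemma integral_gibbs_weight_by_parts:
  assumes U: "superquadratic U" "\<And>x. (U has_real_derivative U' x) (at x)"
    and U': "continuous_on UNIV U'" and \<epsilon>: "\<epsilon> > 0"
    and int: "integrable lborel (\<lambda>x. U' x * gibbs_weight U \<epsilon> c x)"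
  shows "(\<integral>x. U' x * gibbs_weight U \<epsilon> c x \<partial>lborel) = c * (\<integral>x. gibbs_weight U \<epsilon> c x \<partial>lborel)"
proof -
  let ?w = "gibbs_weight U \<epsilon> c"
  have U_cont: "continuous_on UNIV U"
    using U(2) by (meson DERIV_isCont continuous_at_imp_continuous_on)
  have w_int: "integrable lborel ?w"
    using integrable_gibbs_weight[OF U(1) U_cont \<epsilon>] .
  have int': "integrable lborel (\<lambda>x. (- \<epsilon>) * (U' x * ?w x - c * ?w x))"
    using int w_int by (intro integrable_mult_right Bochner_Integration.integrable_diff) auto
  have "(\<integral>x. (- \<epsilon>) * (U' x * ?w x - c * ?w x) \<partial>lborel) = 0"
  proof (rule integral_derivative_eq_0[OF _ _ int' gibbs_weight_tendsto_0[OF U(1) \<epsilon>]])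
    show "(?w has_real_derivative (- \<epsilon>) * (U' x * ?w x - c * ?w x)) (at x)" for x
      unfolding gibbs_weight_def
      by (auto intro!: derivative_eq_intros U(2) simp: algebra_simps)
    show "continuous_on UNIV (\<lambda>x. (- \<epsilon>) * (U' x * ?w x - c * ?w x))"
      unfolding gibbs_weight_def by (intro continuous_intros U' U_cont)
  qed
  then show ?thesis
    using \<epsilon> int w_int by simp
qed

section \<open>Reflection and symmetrization\<close>

lemma lborel_integral_reflect: "(\<integral>x. f (- x) \<partial>lborel) = (\<integral>x. f x \<partial>lborel)"
  for f :: "real \<Rightarrow> real"
  using lborel_integral_real_affine[of "-1" f 0] by simp

lemma lborel_integrable_reflect: "integrable lborel f \<Longrightarrow> integrable lborel (\<lambda>x. f (- x))"
  for f :: "real \<Rightarrow> real"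
  using lborel_integrable_real_affine[of f "-1" 0] by simp

lemma gibbs_weight_reflect:
  assumes "\<And>x. U (- x) = U x"
  shows "gibbs_weight U \<epsilon> c (- x) = gibbs_weight U \<epsilon> (- c) x"
  by (simp add: gibbs_weight_def assms)

lemma gibbs_first_moment_reflect:
  assumes "\<And>x. U (- x) = U x"
  shows "(\<integral>x. x * gibbs_weight U \<epsilon> (- c) x \<partial>lborel) = - (\<integral>x. x * gibbs_weight U \<epsilon> c x \<partial>lborel)"
  using lborel_integral_reflect[of "\<lambda>x. x * gibbs_weight U \<epsilon> c x"]
  by (simp add: gibbs_weight_reflect[of U, OF assms])

lemma gibbs_weight_mass_reflect:
  assumes "\<And>x. U (- x) = U x"
  shows "(\<integral>x. gibbs_weight U \<epsilon> (- c) x \<partial>lborel) = (\<integral>x. gibbs_weight U \<epsilon> c x \<partial>lborel)"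
  using lborel_integral_reflect[of "gibbs_weight U \<epsilon> c"]
  by (simp add: gibbs_weight_reflect[of U, OF assms])

text \<open>Averaging the integrand with its reflection keeps the integral. For odd \<open>f\<close>
  this replaces the tilt \<open>exp (\<epsilon> * c * x)\<close> by its odd part, against the
  untilted weight.\<close>

lemma integral_odd_gibbs_weight:
  fixes f :: "real \<Rightarrow> real"
  assumes U: "\<And>x. U (- x) = U x" and f: "\<And>x. f (- x) = - f x"
    and int: "integrable lborel (\<lambda>x. f x * gibbs_weight U \<epsilon> c x)"
  shows "(\<integral>x. f x * gibbs_weight U \<epsilon> c x \<partial>lborel)
       = (\<integral>x. f x * sinh (\<epsilon> * c * x) * gibbs_weight U \<epsilon> 0 x \<partial>lborel)"
    "integrable lborel (\<lambda>x. f x * sinh (\<epsilon> * c * x) * gibbs_weight U \<epsilon> 0 x)"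
proof -
  let ?g = "\<lambda>x. f x * gibbs_weight U \<epsilon> c x"
  have eq: "(?g x + ?g (- x)) / 2 = f x * sinh (\<epsilon> * c * x) * gibbs_weight U \<epsilon> 0 x" for x
  proof -
    have "gibbs_weight U \<epsilon> c x = exp (\<epsilon> * c * x) * gibbs_weight U \<epsilon> 0 x"
      "gibbs_weight U \<epsilon> c (- x) = exp (- (\<epsilon> * c * x)) * gibbs_weight U \<epsilon> 0 x"
      by (simp_all add: gibbs_weight_def U algebra_simps flip: exp_add)
    then show ?thesis
      by (simp add: f sinh_field_def field_simps)
  qed
  have int2: "integrable lborel (\<lambda>x. ?g (- x))"
    using lborel_integrable_reflect[OF int] .
  have "(\<integral>x. (?g x + ?g (- x)) / 2 \<partial>lborel) = ((\<integral>x. ?g x \<partial>lborel) + (\<integral>x. ?g (- x) \<partial>lborel)) / 2"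
    using Bochner_Integration.integral_add[OF int int2] by simp
  also have "\<dots> = (\<integral>x. ?g x \<partial>lborel)"
    using lborel_integral_reflect[of ?g] by simp
  finally show "(\<integral>x. ?g x \<partial>lborel) = (\<integral>x. f x * sinh (\<epsilon> * c * x) * gibbs_weight U \<epsilon> 0 x \<partial>lborel)"
    by (simp only: eq)
  have "integrable lborel (\<lambda>x. (?g x + ?g (- x)) / 2)"
    using int int2 by (intro integrable_divide Bochner_Integration.integrable_add) auto
  then show "integrable lborel (\<lambda>x. f x * sinh (\<epsilon> * c * x) * gibbs_weight U \<epsilon> 0 x)"
    by (simp only: eq)
qed

text \<open>After symmetrization the integrand contains
  \<open>x * sinh (\<epsilon> * c * x)\<close>, whose two factors never have opposite signs.\<close>

lemma gibbs_first_moment_nonneg: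
  assumes U: "superquadratic U" "continuous_on UNIV U" "\<And>x. U (- x) = U x"
    and \<epsilon>: "\<epsilon> > 0" and c: "c \<ge> 0"
  shows "(\<integral>x. x * gibbs_weight U \<epsilon> c x \<partial>lborel) \<ge> 0"
proof -
  have "x * sinh (\<epsilon> * c * x) \<ge> 0" for x
    using \<epsilon> c by (cases "x \<ge> 0") (auto simp: zero_le_mult_iff mult_nonneg_nonpos)
  then show ?thesis
    using integrable_power_gibbs_weight[OF U(1,2) \<epsilon>, of 1 c]
    by (subst integral_odd_gibbs_weight(1)[of U, OF U(3)])
      (auto intro!: integral_nonneg_AE mult_nonneg_nonneg simp: gibbs_weight_pos less_imp_le)
qed

section \<open>Monotonicity of \<open>sinh x / x\<close> and its use with a sign change\<close>

text \<open>The numerator \<open>t * cosh t - sinh t\<close> of the derivative vanishes at 0 and has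
  derivative \<open>t * sinh t\<close>, which is nonnegative on the half line.\<close>

lemma sinh_div_mono:
  fixes x y :: real
  assumes "0 < x" "x \<le> y"
  shows "sinh x / x \<le> sinh y / y"
proof (rule DERIV_nonneg_imp_nondecreasing[OF assms(2), where f = "\<lambda>t. sinh t / t"])
  fix t assume t: "x \<le> t" "t \<le> y"
  have "sinh t \<le> t * cosh t"
  proof -
    have "0 * cosh 0 - sinh 0 \<le> t * cosh t - sinh t"
    proof (rule DERIV_nonneg_imp_nondecreasing[where f = "\<lambda>t. t * cosh t - sinh t"])
      fix s assume s: "0 \<le> s" "s \<le> t"
      have "((\<lambda>s. s * cosh s - sinh s) has_real_derivative s * sinh s) (at s)"
        by (auto intro!: derivative_eq_intros)
      then show "\<exists>y. ((\<lambda>s. s * cosh s - sinh s) has_real_derivative y) (at s) \<and> 0 \<le> y"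
        using s by (intro exI[of _ "s * sinh s"]) auto
    qed (use assms t in auto)
    then show ?thesis by simp
  qed
  moreover have "((\<lambda>t. sinh t / t) has_real_derivative (cosh t * t - sinh t) / (t * t)) (at t)"
    using assms t by (auto intro!: derivative_eq_intros)
  ultimately show "\<exists>y. ((\<lambda>t. sinh t / t) has_real_derivative y) (at t) \<and> 0 \<le> y"
    by (intro exI[of _ "(cosh t * t - sinh t) / (t * t)"]) (auto simp: mult.commute)
qed

text \<open>Since \<open>sinh (\<beta> x) / x\<close> is increasing and \<open>g\<close> changes sign exactly once, at \<open>r\<close>, freezing
  this quotient at its value at \<open>r\<close> can only decrease the product.\<close>

lemma sign_change_mult_sinh:
  fixes g :: "real \<Rightarrow> real"
  assumes r: "r > 0" and \<beta>: "\<beta> > 0"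
    and g: "\<And>x. \<bar>x\<bar> \<le> r \<Longrightarrow> g x \<le> 0" "\<And>x. r \<le> \<bar>x\<bar> \<Longrightarrow> g x \<ge> 0"
  shows "sinh (\<beta> * r) / r * (x\<^sup>2 * g x) \<le> x * g x * sinh (\<beta> * x)"
proof (cases "x = 0")
  case False
  have quot: "sinh (\<beta> * u) / u \<le> sinh (\<beta> * v) / v" if "0 < u" "u \<le> v" for u v
    using sinh_div_mono[of "\<beta> * u" "\<beta> * v"] that \<beta> by (simp add: field_simps)
  have abs: "x * sinh (\<beta> * x) = x\<^sup>2 * (sinh (\<beta> * \<bar>x\<bar>) / \<bar>x\<bar>)"
    using False by (cases "x > 0") (auto simp: power2_eq_square)
  have "sinh (\<beta> * r) / r * g x \<le> sinh (\<beta> * \<bar>x\<bar>) / \<bar>x\<bar> * g x"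
  proof (cases "\<bar>x\<bar> \<le> r")
    case True
    then show ?thesis using quot[of "\<bar>x\<bar>" r] g(1) False by (intro mult_right_mono_neg) auto
  next
    case False
    then show ?thesis using quot[of r "\<bar>x\<bar>"] g(2) r by (intro mult_right_mono) auto
  qed
  then have "x\<^sup>2 * (sinh (\<beta> * r) / r * g x) \<le> x\<^sup>2 * (sinh (\<beta> * \<bar>x\<bar>) / \<bar>x\<bar> * g x)"
    by (intro mult_left_mono) auto
  then show ?thesis
    using abs by (metis (no_types, opaque_lifting) mult.assoc mult.commute)
qed simp

section \<open>Double-well potentials\<close>

text \<open>This is \<open>V' x / x\<close> for \<open>V = even_potential p \<theta>\<close>,
  written as a polynomial so that its value at 0 is \<open>- \<theta> 2\<close> and not a default of
  division.\<close>

definition slope :: "nat \<Rightarrow> (nat \<Rightarrow> real) \<Rightarrow> real \<Rightarrow> real" where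
  "slope p \<theta> x = - \<theta> 2 + (\<Sum>l = 2..p. \<theta> (2 * l) * x ^ (2 * l - 2))"

text \<open>Expanding the quadratic interactions sends their \<open>x\<^sup>2\<close> part here,
  with \<open>b\<close> the total weighted strength; their linear part becomes the tilt of the Gibbs
  weight.\<close>

definition confined_potential :: "nat \<Rightarrow> (nat \<Rightarrow> real) \<Rightarrow> real \<Rightarrow> real \<Rightarrow> real" where
  "confined_potential p \<theta> b x = even_potential p \<theta> x + b / 2 * x\<^sup>2"

text \<open>The data of a single species, so that the one-dimensional estimates are proved once and
  then used for every component.\<close>

locale double_well =
  fixes p :: nat and \<theta> :: "nat \<Rightarrow> real" and b :: real
  assumes b: "b \<ge> 0" and p_ge: "p \<ge> 2" and theta_2: "\<theta> 2 > 0" and theta_lead: "\<theta> (2 * p) > 0"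
    and theta_mid: "\<And>i. 2 \<le> i \<Longrightarrow> i \<le> p - 1 \<Longrightarrow> \<theta> (2 * i) \<ge> 0"
begin

abbreviation V where "V \<equiv> even_potential p \<theta>"
abbreviation g where "g \<equiv> slope p \<theta>"
abbreviation U where "U \<equiv> confined_potential p \<theta> b"

lemma theta_nonneg: "2 \<le> l \<Longrightarrow> l \<le> p \<Longrightarrow> \<theta> (2 * l) \<ge> 0"
  using theta_mid[of l] theta_lead by (cases "l = p") auto

lemma V_even: "V (- x) = V x"
  by (simp add: even_potential_def)

lemma g_even: "g \<bar>x\<bar> = g x"
proof -
  have "\<bar>x\<bar> ^ (2 * l - 2) = x ^ (2 * l - 2)" for l
    by (simp add: power_even_abs)
  then show ?thesis by (simp add: slope_def)
qed

lemma V_has_derivative: "(V has_real_derivative x * g x) (at x)"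
proof -
  have pow: "x ^ (2 * l - Suc 0) = x * x ^ (2 * l - 2)" if "l \<in> {2..p}" for l
    using that by (cases l) auto
  have "(\<Sum>l = 2..p. \<theta> (2 * l) / real (2 * l) * (real (2 * l) * x ^ (2 * l - Suc 0)))
      = x * (\<Sum>l = 2..p. \<theta> (2 * l) * x ^ (2 * l - 2))"
    unfolding sum_distrib_left by (intro sum.cong) (auto simp: pow)
  then have eq: "- (\<theta> 2 / 2) * (2 * x) +
      (\<Sum>l = 2..p. \<theta> (2 * l) / real (2 * l) * (real (2 * l) * x ^ (2 * l - Suc 0))) = x * g x"
    by (simp add: slope_def algebra_simps)
  have "(V has_real_derivative - (\<theta> 2 / 2) * (2 * x) +
      (\<Sum>l = 2..p. \<theta> (2 * l) / real (2 * l) * (real (2 * l) * x ^ (2 * l - Suc 0)))) (at x)"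
    unfolding even_potential_def[abs_def]
    by (intro derivative_intros DERIV_cmult DERIV_sum) (auto intro!: derivative_eq_intros)
  then show ?thesis using eq by simp
qed

lemma V_continuous: "continuous_on A V"
  unfolding even_potential_def[abs_def] by (intro continuous_intros)

lemma g_continuous: "continuous_on A g"
  unfolding slope_def[abs_def] by (intro continuous_intros)

lemma g_mono:
  assumes "0 \<le> x" "x \<le> y"
  shows "g x \<le> g y"
  using assms theta_nonneg unfolding slope_def
  by (auto intro!: sum_mono mult_left_mono power_mono)

lemma g_ge_lead: "x \<ge> 0 \<Longrightarrow> g x \<ge> - \<theta> 2 + \<theta> (2 * p) * x ^ (2 * p - 2)"
  using member_le_sum[of p "{2..p}" "\<lambda>l. \<theta> (2 * l) * x ^ (2 * l - 2)"] p_ge theta_nonneg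
  by (simp add: slope_def)

lemma V_ge_lead: "V x \<ge> - (\<theta> 2 / 2) * x\<^sup>2 + \<theta> (2 * p) / real (2 * p) * x ^ (2 * p)"
proof -
  have "\<theta> (2 * p) / real (2 * p) * x ^ (2 * p)
      \<le> (\<Sum>l = 2..p. \<theta> (2 * l) / real (2 * l) * x ^ (2 * l))"
    using p_ge theta_nonneg
    by (intro member_le_sum[of p "{2..p}" "\<lambda>l. \<theta> (2 * l) / real (2 * l) * x ^ (2 * l)"]) auto
  then show ?thesis by (simp add: even_potential_def)
qed

lemma V_superquadratic: "superquadratic V"
  unfolding superquadratic_def
proof
  fix K :: real
  define L where "L = \<bar>K\<bar> + \<theta> 2 / 2"
  define q where "q = \<theta> (2 * p) / real (2 * p)"
  \<comment> \<open>Beyond \<open>T\<close> one has \<open>L \<le> q * x\<^sup>2\<close>, and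
    \<open>x\<^sup>2 \<ge> 1\<close> allows passing from \<open>(x\<^sup>2) ^ 2\<close> to
    \<open>(x\<^sup>2) ^ p\<close>; below \<open>T\<close> the constant \<open>L * T\<close>
    suffices.\<close>
  define T where "T = max 1 (L / q)"
  have L: "L \<ge> 0" and q: "q > 0"
    using theta_2 theta_lead p_ge by (auto simp: L_def q_def)
  have "K * x\<^sup>2 \<le> V x + L * T" for x
  proof -
    have "L * x\<^sup>2 \<le> q * x ^ (2 * p) + L * T"
    proof (cases "x\<^sup>2 \<le> T")
      case True
      then have "L * x\<^sup>2 \<le> L * T" using L by (intro mult_left_mono) auto
      moreover have "q * x ^ (2 * p) \<ge> 0" using q by simp
      ultimately show ?thesis by linarith
    next
      case False
      then have t: "x\<^sup>2 \<ge> 1" "L / q \<le> x\<^sup>2" by (auto simp: T_def)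
      have "L * x\<^sup>2 \<le> (q * x\<^sup>2) * x\<^sup>2"
        using t(2) q by (intro mult_right_mono) (auto simp: field_simps)
      also have "\<dots> = q * (x\<^sup>2) ^ 2" by (simp add: power2_eq_square)
      also have "\<dots> \<le> q * (x\<^sup>2) ^ p"
        using t(1) p_ge q by (intro mult_left_mono power_increasing) auto
      also have "\<dots> \<le> q * x ^ (2 * p) + L * T"
        using L by (simp add: power_mult T_def)
      finally show ?thesis .
    qed
    moreover have "K * x\<^sup>2 \<le> \<bar>K\<bar> * x\<^sup>2" by (intro mult_right_mono) auto
    ultimately show ?thesis
      using V_ge_lead[of x] by (simp add: L_def q_def algebra_simps)
  qed
  then show "\<exists>C. \<forall>x. K * x\<^sup>2 \<le> V x + C" by blast
qed

lemma g_ge_1: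
  obtains R where "R \<ge> 1" "\<And>x. R \<le> \<bar>x\<bar> \<Longrightarrow> g x \<ge> 1"
proof -
  \<comment> \<open>The \<open>1\<close> ensures \<open>R \<le> R ^ (2 * p - 2)\<close>, so the
    leading term at \<open>R\<close> is at least \<open>\<theta> 2 + 1\<close>.\<close>
  define R where "R = max 1 ((\<theta> 2 + 1) / \<theta> (2 * p))"
  have R: "R \<ge> 1" "R \<ge> (\<theta> 2 + 1) / \<theta> (2 * p)" by (auto simp: R_def)
  have "R ^ 1 \<le> R ^ (2 * p - 2)" using R(1) p_ge by (intro power_increasing) auto
  then have "\<theta> 2 + 1 \<le> \<theta> (2 * p) * R ^ (2 * p - 2)"
  proof -
    have "\<theta> 2 + 1 = \<theta> (2 * p) * ((\<theta> 2 + 1) / \<theta> (2 * p))" using theta_lead by simp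
    also have "\<dots> \<le> \<theta> (2 * p) * R ^ (2 * p - 2)"
      using R(2) \<open>R ^ 1 \<le> _\<close> theta_lead by (intro mult_left_mono) auto
    finally show ?thesis .
  qed
  then have "g R \<ge> 1" using g_ge_lead[of R] R(1) by simp
  then have "g x \<ge> 1" if "R \<le> \<bar>x\<bar>" for x
    using g_mono[OF _ that] R(1) by (simp add: g_even)
  with R(1) show ?thesis by (rule that)
qed

text \<open>The function \<open>g\<close> is negative at 0 and at least 1 far out, so it has a zero
  in between; evenness and monotonicity on the half line spread the signs from there.\<close>

lemma g_sign_change:
  obtains r where "r > 0" "\<And>x. \<bar>x\<bar> \<le> r \<Longrightarrow> g x \<le> 0" "\<And>x. r \<le> \<bar>x\<bar> \<Longrightarrow> g x \<ge> 0"
proof -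
  obtain R where R: "R \<ge> 1" "\<And>x. R \<le> \<bar>x\<bar> \<Longrightarrow> g x \<ge> 1" using g_ge_1 by blast
  \<comment> \<open>From \<open>l \<ge> 2\<close> the exponent is positive, so no term
    \<open>0 ^ 0 = 1\<close> arises.\<close>
  have "(\<Sum>l = 2..p. \<theta> (2 * l) * 0 ^ (2 * l - 2)) = 0"
    by (intro sum.neutral) auto
  then have g0: "g 0 < 0" using theta_2 by (simp add: slope_def)
  obtain r where r: "0 \<le> r" "r \<le> R" "g r = 0"
    using IVT'[of g 0 0 R] g0 R(1) R(2)[of R] g_continuous by auto
  then have "r > 0" using g0 by (cases "r = 0") auto
  moreover have "g x \<le> 0" if "\<bar>x\<bar> \<le> r" for x
    using g_mono[OF _ that] r by (simp add: g_even)
  moreover have "g x \<ge> 0" if "r \<le> \<bar>x\<bar>" for x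
    using g_mono[OF _ that] r by (simp add: g_even)
  ultimately show ?thesis by (rule that)
qed

lemma U_superquadratic: "superquadratic U"
  unfolding confined_potential_def[abs_def]
  using superquadratic_add_square[OF V_superquadratic, of "b / 2"] b by simp

lemma U_continuous: "continuous_on A U"
  unfolding confined_potential_def[abs_def] by (intro continuous_intros V_continuous)

lemma U_even: "U (- x) = U x"
  by (simp add: confined_potential_def V_even)

lemma U_has_derivative: "(U has_real_derivative x * g x + b * x) (at x)"
  unfolding confined_potential_def[abs_def] by (auto intro!: derivative_eq_intros V_has_derivative)

text \<open>As \<open>g\<close> is a polynomial, the integrand is a finite combination of monomials
  times the weight.\<close>

lemma integrable_power_g_gibbs_weight:
  assumes "\<epsilon> > 0"
  shows "integrable lborel (\<lambda>x. x ^ n * g x * gibbs_weight U \<epsilon> c x)"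
proof -
  note int = integrable_power_gibbs_weight[OF U_superquadratic U_continuous assms, of _ c]
  have "integrable lborel (\<lambda>x. - \<theta> 2 * (x ^ n * gibbs_weight U \<epsilon> c x) +
      (\<Sum>l = 2..p. \<theta> (2 * l) * (x ^ (n + (2 * l - 2)) * gibbs_weight U \<epsilon> c x)))"
    by (intro Bochner_Integration.integrable_add integrable_mult_right int
        Bochner_Integration.integrable_sum)
  moreover have "- \<theta> 2 * (x ^ n * gibbs_weight U \<epsilon> c x) +
      (\<Sum>l = 2..p. \<theta> (2 * l) * (x ^ (n + (2 * l - 2)) * gibbs_weight U \<epsilon> c x))
      = x ^ n * g x * gibbs_weight U \<epsilon> c x" for x
  proof -
    have "(\<Sum>l = 2..p. \<theta> (2 * l) * (x ^ (n + (2 * l - 2)) * gibbs_weight U \<epsilon> c x))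
        = (\<Sum>l = 2..p. \<theta> (2 * l) * x ^ (2 * l - 2)) * (x ^ n * gibbs_weight U \<epsilon> c x)"
      unfolding power_add sum_distrib_right by (intro sum.cong) (simp_all only: mult_ac)
    then show ?thesis by (simp add: slope_def algebra_simps)
  qed
  ultimately show ?thesis by simp
qed

text \<open>As \<open>\<epsilon> \<rightarrow> 0\<close> the weight tends to \<open>1\<close> on \<open>[-N, N]\<close>, where \<open>N\<close> is so large that the part on which
  \<open>x * V' x \<ge> 1\<close> outweighs the well, on which \<open>x * V' x \<ge> - \<theta> 2 * R\<^sup>2\<close>. The factor \<open>exp 2\<close> absorbs
  the oscillation of a weight between \<open>exp (-1)\<close> and \<open>exp 1\<close>.\<close>

lemma virial_pos_small:
  obtains \<epsilon>\<^sub>0 where "\<epsilon>\<^sub>0 > 0"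
    "\<And>\<epsilon>. 0 < \<epsilon> \<Longrightarrow> \<epsilon> \<le> \<epsilon>\<^sub>0 \<Longrightarrow> (\<integral>x. x\<^sup>2 * g x * gibbs_weight U \<epsilon> 0 x \<partial>lborel) > 0"
proof -
  obtain R where R: "R \<ge> 1" "\<And>x. R \<le> \<bar>x\<bar> \<Longrightarrow> g x \<ge> 1" using g_ge_1 by blast
  define C where "C = \<theta> 2 * R\<^sup>2"
  define N where "N = R + 2 * R * C * exp 2 + 1"
  have C: "C > 0" using theta_2 R(1) by (simp add: C_def)
  have N: "N \<ge> R" using C R(1) by (simp add: N_def)
  have "bounded (U ` {-N..N})"
    by (intro compact_imp_bounded compact_continuous_image U_continuous) auto
  then obtain B where B: "B > 0" "\<And>x. x \<in> {-N..N} \<Longrightarrow> \<bar>U x\<bar> \<le> B"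
    unfolding bounded_pos by auto
  \<comment> \<open>The bound \<open>1 / B\<close> keeps
    \<open>\<bar>\<epsilon> * U x\<bar> \<le> 1\<close> on \<open>{-N..N}\<close>, hence the weight
    between \<open>exp (-1)\<close> and \<open>exp 1\<close>.\<close>
  have "(\<integral>x. x\<^sup>2 * g x * gibbs_weight U \<epsilon> 0 x \<partial>lborel) > 0" if \<epsilon>: "0 < \<epsilon>" "\<epsilon> \<le> 1 / B" for \<epsilon>
  proof -
    let ?w = "gibbs_weight U \<epsilon> 0"
    \<comment> \<open>A step function below the integrand: a worst case for the well on
      \<open>{-R..R}\<close>, and a gain on the right outer piece only, since \<open>0\<close> is a
      sufficient lower bound elsewhere.\<close>
    let ?h = "\<lambda>x. - C * exp 1 * indicator {-R..R} x + exp (-1) * indicator {R<..N} x :: real"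
    have w: "exp (-1) \<le> ?w x" "?w x \<le> exp 1" if "x \<in> {-N..N}" for x
    proof -
      have "\<epsilon> * \<bar>U x\<bar> \<le> 1 / B * B"
        using \<epsilon> B(2)[OF that] B(1) by (intro mult_mono) auto
      then have "\<bar>\<epsilon> * U x\<bar> \<le> 1" using \<epsilon>(1) B(1) by (simp add: abs_mult)
      then show "exp (-1) \<le> ?w x" "?w x \<le> exp 1"
        unfolding gibbs_weight_def by (simp_all add: abs_le_iff)
    qed
    have le: "?h x \<le> x\<^sup>2 * g x * ?w x" for x
    proof (cases "\<bar>x\<bar> \<le> R")
      case True
      have g_lower: "g x \<ge> - \<theta> 2"
        unfolding slope_def using theta_nonneg by (auto intro!: sum_nonneg mult_nonneg_nonneg zero_le_even_power)
      have "x\<^sup>2 \<le> R\<^sup>2" using True by (simp add: abs_le_square_iff[symmetric])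
      then have "x\<^sup>2 * \<theta> 2 \<le> C" using theta_2 by (simp add: C_def)
      moreover have "x\<^sup>2 * (- \<theta> 2) \<le> x\<^sup>2 * g x"
        using g_lower by (intro mult_left_mono) auto
      ultimately have "- C \<le> x\<^sup>2 * g x" by simp
      then have "- C * ?w x \<le> x\<^sup>2 * g x * ?w x"
        using gibbs_weight_pos[of U \<epsilon> 0 x] by (intro mult_right_mono) auto
      moreover have "- C * exp 1 \<le> - C * ?w x"
        using w(2)[of x] True N C by (intro mult_left_mono_neg) (auto simp: abs_le_iff)
      ultimately show ?thesis using True by (auto simp: indicator_def abs_le_iff)
    next
      case False
      then have "1 \<le> x\<^sup>2"
        using R(1) abs_le_square_iff[of 1 x] by simp
      then have "1 * 1 \<le> x\<^sup>2 * g x"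
        using R(2)[of x] False by (intro mult_mono) auto
      then have "?w x \<le> x\<^sup>2 * g x * ?w x"
        using mult_right_mono[of 1 "x\<^sup>2 * g x" "?w x"] gibbs_weight_pos[of U \<epsilon> 0 x] by simp
      moreover have "?h x \<le> ?w x"
        using w(1)[of x] gibbs_weight_pos[of U \<epsilon> 0 x] False N R(1) by (auto simp: indicator_def)
      ultimately show ?thesis by (rule order_trans[rotated])
    qed
    \<comment> \<open>As \<open>N - R = 2 * R * C * exp 2 + 1\<close>, the negative area
      \<open>2 * R * C * exp 1\<close> is compensated with exactly \<open>exp (-1)\<close> to
      spare.\<close>
    have "exp (-1) * exp 2 = exp (1 :: real)" by (simp flip: exp_add)
    then have "0 < - C * exp 1 * (2 * R) + exp (-1) * (N - R)"
      by (simp add: N_def algebra_simps)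
    also have "\<dots> = (\<integral>x. ?h x \<partial>lborel)"
      using R(1) N by (subst Bochner_Integration.integral_add) auto
    also have "\<dots> \<le> (\<integral>x. x\<^sup>2 * g x * ?w x \<partial>lborel)"
      using R(1) N by (intro integral_mono integrable_power_g_gibbs_weight \<epsilon> le) auto
    finally show ?thesis .
  qed
  then show ?thesis using B(1) by (intro that[of "1 / B"]) auto
qed

section \<open>The strict bound on the tilted mean\<close>

text \<open>By integration by parts the gap between the two sides is the integral of
  \<open>V'\<close> against the tilted weight. Symmetrization and
  \<open>sign_change_mult_sinh\<close> bound it below by a positive multiple of the integral in
  \<open>virial\<close>.\<close>

lemma tilted_mean_less:
  assumes \<epsilon>: "\<epsilon> > 0" and c: "c > 0"
    and virial: "(\<integral>x. x\<^sup>2 * g x * gibbs_weight U \<epsilon> 0 x \<partial>lborel) > 0"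
  shows "b * (\<integral>x. x * gibbs_weight U \<epsilon> c x \<partial>lborel) < c * (\<integral>x. gibbs_weight U \<epsilon> c x \<partial>lborel)"
proof -
  obtain r where r: "r > 0" "\<And>x. \<bar>x\<bar> \<le> r \<Longrightarrow> g x \<le> 0" "\<And>x. r \<le> \<bar>x\<bar> \<Longrightarrow> g x \<ge> 0"
    using g_sign_change by blast
  let ?w = "gibbs_weight U \<epsilon> c" and ?v = "gibbs_weight U \<epsilon> 0"
  define K where "K = sinh (\<epsilon> * c * r) / r"
  have K: "K > 0" using r(1) \<epsilon> c by (simp add: K_def)
  have xg_odd: "- x * g (- x) = - (x * g x)" for x
    using g_even[of x] g_even[of "- x"] by simp
  have int_xg: "integrable lborel (\<lambda>x. x * g x * ?w x)"
    using integrable_power_g_gibbs_weight[OF \<epsilon>, of 1 c] by simp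
  have int_x: "integrable lborel (\<lambda>x. x * ?w x)"
    using integrable_power_gibbs_weight[OF U_superquadratic U_continuous \<epsilon>, of 1 c] by simp
  note sym = integral_odd_gibbs_weight[of U "\<lambda>x. x * g x", OF U_even xg_odd int_xg]
  have "0 < K * (\<integral>x. x\<^sup>2 * g x * ?v x \<partial>lborel)"
    using K virial by simp
  also have "\<dots> = (\<integral>x. K * (x\<^sup>2 * g x * ?v x) \<partial>lborel)"
    by simp
  also have "\<dots> \<le> (\<integral>x. x * g x * sinh (\<epsilon> * c * x) * ?v x \<partial>lborel)"
  proof (rule integral_mono)
    show "integrable lborel (\<lambda>x. K * (x\<^sup>2 * g x * ?v x))"
      by (intro integrable_mult_right integrable_power_g_gibbs_weight \<epsilon>)
    show "integrable lborel (\<lambda>x. x * g x * sinh (\<epsilon> * c * x) * ?v x)"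
      by (rule sym(2))
    fix x
    have "K * (x\<^sup>2 * g x) \<le> x * g x * sinh (\<epsilon> * c * x)"
      unfolding K_def using \<epsilon> c by (intro sign_change_mult_sinh r) auto
    from mult_right_mono[OF this less_imp_le[OF gibbs_weight_pos[of U \<epsilon> 0 x]]]
    show "K * (x\<^sup>2 * g x * ?v x) \<le> x * g x * sinh (\<epsilon> * c * x) * ?v x"
      by (simp add: mult.assoc)
  qed
  also have "\<dots> = (\<integral>x. x * g x * ?w x \<partial>lborel)"
    by (rule sym(1)[symmetric])
  finally have pos: "0 < (\<integral>x. x * g x * ?w x \<partial>lborel)" .
  have int: "integrable lborel (\<lambda>x. x * g x * ?w x + b * (x * ?w x))"
    using int_xg int_x by (intro Bochner_Integration.integrable_add integrable_mult_right)
  have "(\<integral>x. (x * g x + b * x) * ?w x \<partial>lborel) = c * (\<integral>x. ?w x \<partial>lborel)"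
    using int by (intro integral_gibbs_weight_by_parts U_superquadratic U_has_derivative \<epsilon>
        continuous_intros g_continuous) (simp add: algebra_simps)
  moreover have "(\<integral>x. (x * g x + b * x) * ?w x \<partial>lborel)
      = (\<integral>x. x * g x * ?w x \<partial>lborel) + b * (\<integral>x. x * ?w x \<partial>lborel)"
    using int_xg int_x by (simp add: distrib_right mult.assoc)
  ultimately show ?thesis using pos by simp
qed

text \<open>Reversing the tilt flips the first moment and keeps the mass, so it suffices to treat
  \<open>\<bar>c\<bar>\<close>, where the first moment is nonnegative.\<close>

lemma abs_tilted_mean_less:
  assumes \<epsilon>: "\<epsilon> > 0" and c: "c \<noteq> 0"
    and virial: "(\<integral>x. x\<^sup>2 * g x * gibbs_weight U \<epsilon> 0 x \<partial>lborel) > 0"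
  shows "b * \<bar>(\<integral>x. x * gibbs_weight U \<epsilon> c x \<partial>lborel) / (\<integral>x. gibbs_weight U \<epsilon> c x \<partial>lborel)\<bar> < \<bar>c\<bar>"
proof -
  let ?m = "\<lambda>c. (\<integral>x. x * gibbs_weight U \<epsilon> c x \<partial>lborel)"
  let ?Z = "\<lambda>c. (\<integral>x. gibbs_weight U \<epsilon> c x \<partial>lborel)"
  have "?Z \<bar>c\<bar> > 0"
    by (intro integral_gibbs_weight_pos U_superquadratic U_continuous \<epsilon>)
  moreover have "?m \<bar>c\<bar> \<ge> 0"
    by (intro gibbs_first_moment_nonneg U_superquadratic U_continuous U_even \<epsilon>) auto
  moreover have "b * ?m \<bar>c\<bar> < \<bar>c\<bar> * ?Z \<bar>c\<bar>"
    using tilted_mean_less[OF \<epsilon> _ virial] c by simp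
  ultimately have "b * \<bar>?m \<bar>c\<bar> / ?Z \<bar>c\<bar>\<bar> < \<bar>c\<bar>"
    by (simp add: field_simps)
  moreover have "\<bar>?m \<bar>c\<bar> / ?Z \<bar>c\<bar>\<bar> = \<bar>?m c / ?Z c\<bar>"
    using gibbs_first_moment_reflect[of U \<epsilon> c, OF U_even]
      gibbs_weight_mass_reflect[of U \<epsilon> c, OF U_even] by (cases "c \<ge> 0") auto
  ultimately show ?thesis by (simp only:)
qed

lemma untilted_mean: "(\<integral>x. x * gibbs_weight U \<epsilon> 0 x \<partial>lborel) = 0"
  using gibbs_first_moment_reflect[of U \<epsilon> 0, OF U_even] by simp

end

section \<open>From stationary states to Gibbs measures\<close>

lemma self_consistency_weight_eq:
  assumes "V k = even_potential (p k) (\<theta> k)"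
  shows "self_consistency_weight V \<alpha> a \<sigma> m k
       = gibbs_weight (confined_potential (p k) (\<theta> k) (\<Sum>l\<in>UNIV. a $ l * \<alpha> $ k $ l))
           (2 / (\<sigma> $ k)\<^sup>2) (\<Sum>l\<in>UNIV. a $ l * \<alpha> $ k $ l * m $ l)"
  by (rule ext) (simp add: self_consistency_weight_def gibbs_weight_def confined_potential_def assms
      sum_distrib_left sum_distrib_right algebra_simps)

text \<open>Expanding the square separates a confining term, a tilt given by the mean, and a
  constant that normalization will remove.\<close>

lemma conv_quadratic_interaction:
  assumes "prob_space \<mu>" "integrable \<mu> (\<lambda>y. y)" "integrable \<mu> (\<lambda>y. y\<^sup>2)"
  shows "conv (quadratic_interaction \<alpha>) \<mu> x
       = \<alpha> / 2 * x\<^sup>2 - \<alpha> * x * (\<integral>y. y \<partial>\<mu>) + \<alpha> / 2 * (\<integral>y. y\<^sup>2 \<partial>\<mu>)"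
proof -
  interpret prob_space \<mu> by fact
  have "quadratic_interaction \<alpha> (x - y) = \<alpha> / 2 * x\<^sup>2 - \<alpha> * x * y + \<alpha> / 2 * y\<^sup>2" for y
    by (simp add: quadratic_interaction_def power2_eq_square field_simps)
  then show ?thesis
    using assms(2,3) by (simp add: conv_def prob_space)
qed

lemma integrable_density_iff:
  fixes f w :: "real \<Rightarrow> real"
  assumes "\<And>x. w x \<ge> 0" "w \<in> borel_measurable borel" "f \<in> borel_measurable borel"
  shows "integrable (density lborel (\<lambda>x. ennreal (w x))) f \<longleftrightarrow> integrable lborel (\<lambda>x. w x * f x)"
  using assms by (subst integrable_density) auto

lemma prob_space_density_iff:
  fixes w :: "real \<Rightarrow> real"
  assumes w: "\<And>x. w x \<ge> 0" "integrable lborel w"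
  shows "prob_space (density lborel (\<lambda>x. ennreal (w x))) \<longleftrightarrow> (\<integral>x. w x \<partial>lborel) = 1"
proof -
  have [measurable]: "w \<in> borel_measurable borel" using w(2) by simp
  have "emeasure (density lborel (\<lambda>x. ennreal (w x))) (space (density lborel (\<lambda>x. ennreal (w x))))
      = ennreal (\<integral>x. w x \<partial>lborel)"
    using w by (simp add: emeasure_density nn_integral_eq_integral)
  moreover have "(\<integral>x. w x \<partial>lborel) \<ge> 0" using w by (intro integral_nonneg_AE) simp
  ultimately show ?thesis
    by (auto intro!: prob_spaceI dest!: prob_space.emeasure_space_1)
qed

text \<open>Integrability of the diagonal interaction, with \<open>\<alpha> k k > 0\<close>, gives finite second moments.\<close>

lemma stationary_state_moments:
  assumes st: "stationary_state V F a \<sigma> \<mu>"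
    and F: "\<And>k l. F k l = quadratic_interaction (\<alpha> $ k $ l)" and \<alpha>: "\<And>k. \<alpha> $ k $ k > 0"
  shows "prob_space (\<mu> k)" "integrable (\<mu> k) (\<lambda>y. y)" "integrable (\<mu> k) (\<lambda>y. y\<^sup>2)"
proof -
  show ps: "prob_space (\<mu> k)" using st by (simp add: stationary_state_def)
  interpret prob_space "\<mu> k" by fact
  obtain f where "\<mu> k = density lborel f"
    using st unfolding stationary_state_def by blast
  then have [measurable_cong]: "sets (\<mu> k) = sets borel" by simp
  have "integrable (\<mu> k) (\<lambda>y. F k k (0 - y))"
    using st unfolding stationary_state_def by blast
  then have "integrable (\<mu> k) (\<lambda>y. \<alpha> $ k $ k / 2 * y\<^sup>2)"
    by (simp add: F quadratic_interaction_def)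
  then have "integrable (\<mu> k) (\<lambda>y. 2 / \<alpha> $ k $ k * (\<alpha> $ k $ k / 2 * y\<^sup>2))"
    by (rule integrable_mult_right)
  moreover have "2 / \<alpha> $ k $ k * (\<alpha> $ k $ k / 2 * y\<^sup>2) = y\<^sup>2" for y
    using \<alpha>[of k] by simp
  ultimately show int2: "integrable (\<mu> k) (\<lambda>y. y\<^sup>2)"
    by (simp only:)
  show "integrable (\<mu> k) (\<lambda>y. y)"
    by (rule square_integrable_imp_integrable[OF _ int2]) measurable
qed

definition gibbs_measure :: "(real \<Rightarrow> real) \<Rightarrow> real \<Rightarrow> real \<Rightarrow> real measure" where
  "gibbs_measure U \<epsilon> c = density lborel
     (\<lambda>x. ennreal (gibbs_weight U \<epsilon> c x / (\<integral>x. gibbs_weight U \<epsilon> c x \<partial>lborel)))"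

lemma
  assumes U: "superquadratic U" "continuous_on UNIV U" and \<epsilon>: "\<epsilon> > 0"
  shows prob_space_gibbs_measure: "prob_space (gibbs_measure U \<epsilon> c)"
    and integrable_power_gibbs_measure: "integrable (gibbs_measure U \<epsilon> c) (\<lambda>x. x ^ n)"
    and gibbs_measure_mean: "(\<integral>x. x \<partial>gibbs_measure U \<epsilon> c)
      = (\<integral>x. x * gibbs_weight U \<epsilon> c x \<partial>lborel) / (\<integral>x. gibbs_weight U \<epsilon> c x \<partial>lborel)"
proof -
  let ?w = "gibbs_weight U \<epsilon> c"
  let ?Z = "\<integral>x. ?w x \<partial>lborel"
  have Z: "?Z > 0" using integral_gibbs_weight_pos[OF assms] .
  have nn: "?w x / ?Z \<ge> 0" for x using Z gibbs_weight_pos[of U \<epsilon> c x] by simp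
  have int: "integrable lborel ?w" using integrable_gibbs_weight[OF assms] .
  have meas: "(\<lambda>x. ?w x / ?Z) \<in> borel_measurable borel" using int by simp
  show "prob_space (gibbs_measure U \<epsilon> c)"
    unfolding gibbs_measure_def using Z int by (subst prob_space_density_iff) (auto simp: nn)
  have "integrable lborel (\<lambda>x. x ^ n * ?w x / ?Z)"
    by (intro integrable_divide integrable_power_gibbs_weight assms)
  then show "integrable (gibbs_measure U \<epsilon> c) (\<lambda>x. x ^ n)"
    unfolding gibbs_measure_def by (subst integrable_density_iff[OF nn meas]) (auto simp: mult_ac)
  show "(\<integral>x. x \<partial>gibbs_measure U \<epsilon> c) = (\<integral>x. x * ?w x \<partial>lborel) / ?Z"
    unfolding gibbs_measure_def using nn meas by (subst integral_density) (auto simp: mult_ac)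
qed

text \<open>Total mass one determines \<open>C\<close>, so the existentially quantified
  \<open>Z\<close> of a stationary state leaves no freedom.\<close>

lemma density_proportional_gibbs_weight:
  assumes U: "superquadratic U" "continuous_on UNIV U" and \<epsilon>: "\<epsilon> > 0"
    and C: "C \<ge> 0" and ps: "prob_space (density lborel (\<lambda>x. ennreal (C * gibbs_weight U \<epsilon> c x)))"
  shows "density lborel (\<lambda>x. ennreal (C * gibbs_weight U \<epsilon> c x)) = gibbs_measure U \<epsilon> c"
proof -
  have "(\<integral>x. C * gibbs_weight U \<epsilon> c x \<partial>lborel) = 1"
    using ps C integrable_gibbs_weight[OF U \<epsilon>, of c]
    by (subst (asm) prob_space_density_iff) (auto simp: gibbs_weight_pos less_imp_le)
  then have "C = 1 / (\<integral>x. gibbs_weight U \<epsilon> c x \<partial>lborel)"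
    using integral_gibbs_weight_pos[OF U \<epsilon>, of c] by (simp add: field_simps)
  then show ?thesis by (simp add: gibbs_measure_def)
qed

text \<open>The second moments only produce a factor independent of \<open>x\<close>; the shape of
  each component depends on \<open>\<mu>\<close> through the means alone.\<close>

lemma stationary_exponent:
  fixes a \<sigma> :: "real ^ 'm::finite" and \<alpha> :: "real ^ 'm ^ 'm"
  assumes F: "\<And>k l. F k l = quadratic_interaction (\<alpha> $ k $ l)"
    and V: "\<And>k. V k = even_potential (p k) (\<theta> k)"
    and \<mu>: "\<And>l. prob_space (\<mu> l)" "\<And>l. integrable (\<mu> l) (\<lambda>y. y)" "\<And>l. integrable (\<mu> l) (\<lambda>y. y\<^sup>2)"
  shows "exp (- (2 / (\<sigma> $ k) ^ 2) * (V k x + (\<Sum>l\<in>UNIV. a $ l * conv (F k l) (\<mu> l) x)))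
    = exp (- (2 / (\<sigma> $ k)\<^sup>2) * (\<Sum>l\<in>UNIV. a $ l * \<alpha> $ k $ l / 2 * (\<integral>y. y\<^sup>2 \<partial>\<mu> l)))
      * gibbs_weight (confined_potential (p k) (\<theta> k) (\<Sum>l\<in>UNIV. a $ l * \<alpha> $ k $ l))
           (2 / (\<sigma> $ k)\<^sup>2) (\<Sum>l\<in>UNIV. a $ l * \<alpha> $ k $ l * (\<integral>y. y \<partial>\<mu> l)) x"
proof -
  let ?b = "\<Sum>l\<in>UNIV. a $ l * \<alpha> $ k $ l"
    and ?c = "\<Sum>l\<in>UNIV. a $ l * \<alpha> $ k $ l * (\<integral>y. y \<partial>\<mu> l)"
    and ?s = "\<Sum>l\<in>UNIV. a $ l * \<alpha> $ k $ l / 2 * (\<integral>y. y\<^sup>2 \<partial>\<mu> l)"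
  have "(\<Sum>l\<in>UNIV. a $ l * conv (F k l) (\<mu> l) x)
      = (\<Sum>l\<in>UNIV. a $ l * \<alpha> $ k $ l * (x\<^sup>2 / 2) - a $ l * \<alpha> $ k $ l * (\<integral>y. y \<partial>\<mu> l) * x
          + a $ l * \<alpha> $ k $ l / 2 * (\<integral>y. y\<^sup>2 \<partial>\<mu> l))"
    by (intro sum.cong) (auto simp: F conv_quadratic_interaction \<mu> algebra_simps)
  also have "\<dots> = ?b * (x\<^sup>2 / 2) - ?c * x + ?s"
    by (simp add: sum.distrib sum_subtractf sum_distrib_right)
  finally have "V k x + (\<Sum>l\<in>UNIV. a $ l * conv (F k l) (\<mu> l) x)
      = ?s + (confined_potential (p k) (\<theta> k) ?b x - ?c * x)"
    by (simp add: confined_potential_def V)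
  then show ?thesis
    by (simp only: gibbs_weight_def distrib_left exp_add)
qed

section \<open>The coupled mean equations and the conclusion\<close>

text \<open>A discrete maximum principle: at an index maximizing \<open>\<bar>m $ j\<bar>\<close>
  the triangle inequality contradicts \<open>less\<close>, so the weighted sum vanishes there and
  \<open>zero\<close> applies.\<close>

lemma linear_mean_field_zero:
  fixes m :: "real ^ 'm::finite" and A :: "'m \<Rightarrow> 'm \<Rightarrow> real"
  assumes A: "\<And>k l. A k l \<ge> 0"
    and zero: "\<And>k. (\<Sum>l\<in>UNIV. A k l * m $ l) = 0 \<Longrightarrow> m $ k = 0"
    and less: "\<And>k. (\<Sum>l\<in>UNIV. A k l * m $ l) \<noteq> 0 \<Longrightarrow>
      (\<Sum>l\<in>UNIV. A k l) * \<bar>m $ k\<bar> < \<bar>\<Sum>l\<in>UNIV. A k l * m $ l\<bar>"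
  shows "m $ k = 0"
proof -
  have "\<exists>j. \<forall>l. \<bar>m $ l\<bar> \<le> \<bar>m $ j\<bar>"
  proof -
    have "Max (range (\<lambda>l. \<bar>m $ l\<bar>)) \<in> range (\<lambda>l. \<bar>m $ l\<bar>)" by (intro Max_in) auto
    then obtain j where "Max (range (\<lambda>l. \<bar>m $ l\<bar>)) = \<bar>m $ j\<bar>" by blast
    then show ?thesis by (metis Max_ge finite finite_imageI rangeI)
  qed
  then obtain j where j: "\<And>l. \<bar>m $ l\<bar> \<le> \<bar>m $ j\<bar>" by blast
  have "\<bar>\<Sum>l\<in>UNIV. A j l * m $ l\<bar> \<le> (\<Sum>l\<in>UNIV. \<bar>A j l * m $ l\<bar>)" by (rule sum_abs)
  also have "\<dots> \<le> (\<Sum>l\<in>UNIV. A j l * \<bar>m $ j\<bar>)"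
    using A j by (intro sum_mono) (auto simp: abs_mult intro: mult_left_mono)
  also have "\<dots> = (\<Sum>l\<in>UNIV. A j l) * \<bar>m $ j\<bar>" by (simp add: sum_distrib_right)
  finally have "m $ j = 0" using less[of j] zero[of j] by fastforce
  with j[of k] show ?thesis by simp
qed

theorem theorem3p1:
  fixes a :: "real ^ 'm::finite"
    and p :: "'m \<Rightarrow> nat"
    and \<theta> :: "'m \<Rightarrow> nat \<Rightarrow> real"
    and \<alpha> :: "real ^ 'm ^ 'm"
    and V :: "'m \<Rightarrow> real \<Rightarrow> real"
    and F :: "'m \<Rightarrow> 'm \<Rightarrow> real \<Rightarrow> real"
  assumes a_range: "\<And>k. a $ k \<in> {0..1}"
    and a_sum: "(\<Sum>k\<in>UNIV. a $ k) = 1"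
    and p_ge: "\<And>k. p k \<ge> 2"
    and \<theta>_2: "\<And>k. \<theta> k 2 > 0"
    and \<theta>_lead: "\<And>k. \<theta> k (2 * p k) > 0"
    and \<theta>_mid: "\<And>k i. 2 \<le> i \<Longrightarrow> i \<le> p k - 1 \<Longrightarrow> \<theta> k (2 * i) \<ge> 0"
    and V_eq: "\<And>k. V k = even_potential (p k) (\<theta> k)"
    and \<alpha>_nonneg: "\<And>k l. \<alpha> $ k $ l \<ge> 0"
    and \<alpha>_diag: "\<And>k. \<alpha> $ k $ k > 0"
    and F_eq: "\<And>k l. F k l = quadratic_interaction (\<alpha> $ k $ l)"
  shows "\<exists>\<sigma>\<^sub>0>0. \<forall>\<sigma> :: real ^ 'm.
           (\<forall>k. \<sigma> $ k > 0) \<and> (MIN k. \<sigma> $ k) \<ge> \<sigma>\<^sub>0 \<longrightarrow>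
             (\<forall>m. self_consistent V \<alpha> a \<sigma> m \<longleftrightarrow> (\<forall>k. m $ k = 0)) \<and>
             (\<exists>!\<mu>. stationary_state V F a \<sigma> \<mu>) \<and>
             (\<forall>\<mu>. stationary_state V F a \<sigma> \<mu> \<longrightarrow>
                (\<forall>k. integrable (\<mu> k) (\<lambda>x. x) \<and> (\<integral>x. x \<partial>\<mu> k) = 0))"
proof -
  define b where "b k = (\<Sum>l\<in>UNIV. a $ l * \<alpha> $ k $ l)" for k
  define U where "U k = confined_potential (p k) (\<theta> k) (b k)" for k
  have A_nonneg: "a $ l * \<alpha> $ k $ l \<ge> 0" for k l
    using a_range[of l] \<alpha>_nonneg[of k l] by simp
  \<comment> \<open>The index \<open>k\<close> stays free, so every fact of the locale becomes
    available for all species.\<close>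
  interpret D: double_well "p k" "\<theta> k" "b k" for k
    by standard (use p_ge \<theta>_2 \<theta>_lead \<theta>_mid A_nonneg in \<open>auto simp: b_def intro: sum_nonneg\<close>)
  note U_facts = D.U_superquadratic D.U_continuous
  have "\<exists>\<epsilon>\<^sub>0>0. \<forall>\<epsilon>. 0 < \<epsilon> \<and> \<epsilon> \<le> \<epsilon>\<^sub>0 \<longrightarrow>
      (\<integral>x. x\<^sup>2 * slope (p k) (\<theta> k) x * gibbs_weight (U k) \<epsilon> 0 x \<partial>lborel) > 0" for k
    unfolding U_def by (rule D.virial_pos_small[of k]) blast
  then obtain \<epsilon>\<^sub>0 where \<epsilon>\<^sub>0: "\<And>k. \<epsilon>\<^sub>0 k > 0"
    "\<And>k \<epsilon>. 0 < \<epsilon> \<Longrightarrow> \<epsilon> \<le> \<epsilon>\<^sub>0 k \<Longrightarrow>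
      (\<integral>x. x\<^sup>2 * slope (p k) (\<theta> k) x * gibbs_weight (U k) \<epsilon> 0 x \<partial>lborel) > 0"
    by metis
  \<comment> \<open>The condition \<open>\<sigma> $ k \<ge> sqrt (2 / \<epsilon>\<^sub>0 k)\<close>
    gives \<open>2 / (\<sigma> $ k)\<^sup>2 \<le> \<epsilon>\<^sub>0 k\<close>; the maximum over the
    finitely many species serves all of them.\<close>
  define \<sigma>\<^sub>0 where "\<sigma>\<^sub>0 = Max (range (\<lambda>k. sqrt (2 / \<epsilon>\<^sub>0 k)))"
  have \<sigma>\<^sub>0_ge: "\<sigma>\<^sub>0 \<ge> sqrt (2 / \<epsilon>\<^sub>0 k)" for k
    unfolding \<sigma>\<^sub>0_def by (intro Max_ge) auto
  \<comment> \<open>Here \<open>undefined\<close> is merely some index, available because types are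
    nonempty.\<close>
  have \<sigma>\<^sub>0_pos: "\<sigma>\<^sub>0 > 0"
    using less_le_trans[OF _ \<sigma>\<^sub>0_ge[of undefined], of 0] \<epsilon>\<^sub>0(1)[of undefined] by simp
  show ?thesis
  proof (intro exI[of _ \<sigma>\<^sub>0] conjI[OF \<sigma>\<^sub>0_pos] allI impI)
    fix \<sigma> :: "real ^ 'm"
    assume \<sigma>: "(\<forall>k. \<sigma> $ k > 0) \<and> (MIN k. \<sigma> $ k) \<ge> \<sigma>\<^sub>0"
    define \<epsilon> where "\<epsilon> k = 2 / (\<sigma> $ k)\<^sup>2" for k
    have \<epsilon>_pos: "\<epsilon> k > 0" for k using \<sigma> by (simp add: \<epsilon>_def zero_less_power2 less_imp_neq[symmetric])
    have \<epsilon>_le: "\<epsilon> k \<le> \<epsilon>\<^sub>0 k" for k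
    proof -
      have "(MIN k. \<sigma> $ k) \<le> \<sigma> $ k" by (intro Min_le) auto
      then have "sqrt (2 / \<epsilon>\<^sub>0 k) \<le> \<sigma> $ k" using \<sigma> \<sigma>\<^sub>0_ge[of k] by linarith
      then have "2 / \<epsilon>\<^sub>0 k \<le> (\<sigma> $ k)\<^sup>2" by (rule sqrt_le_D)
      moreover have "(\<sigma> $ k)\<^sup>2 > 0" using \<sigma> by (simp add: less_imp_neq[symmetric])
      ultimately show ?thesis using \<epsilon>\<^sub>0(1)[of k]
        by (simp add: \<epsilon>_def pos_divide_le_eq mult.commute)
    qed
    let ?c = "\<lambda>m k. \<Sum>l\<in>UNIV. a $ l * \<alpha> $ k $ l * m $ l"
    let ?mean = "\<lambda>k c. (\<integral>x. x * gibbs_weight (U k) (\<epsilon> k) c x \<partial>lborel) /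
        (\<integral>x. gibbs_weight (U k) (\<epsilon> k) c x \<partial>lborel)"
    have sc_iff: "self_consistent V \<alpha> a \<sigma> m \<longleftrightarrow> (\<forall>k. m $ k = ?mean k (?c m k))" for m
      by (simp add: self_consistent_def self_consistency_weight_eq[of V _ p \<theta>, OF V_eq] U_def b_def \<epsilon>_def)
    have mean0: "?mean k 0 = 0" for k
      using D.untilted_mean[of k "\<epsilon> k"] by (simp add: U_def)
    have sc: "self_consistent V \<alpha> a \<sigma> m \<longleftrightarrow> (\<forall>k. m $ k = 0)" for m
    proof
      assume "self_consistent V \<alpha> a \<sigma> m"
      then have m: "m $ k = ?mean k (?c m k)" for k
        unfolding sc_iff by (rule spec)
      have "m $ k = 0" if "?c m k = 0" for k
        by (subst m[of k]) (simp only: that mean0)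
      moreover have "b k * \<bar>m $ k\<bar> < \<bar>?c m k\<bar>" if "?c m k \<noteq> 0" for k
        using D.abs_tilted_mean_less[OF \<epsilon>_pos that \<epsilon>\<^sub>0(2)[OF \<epsilon>_pos \<epsilon>_le, unfolded U_def]]
        by (subst m[of k]) (simp only: U_def)
      ultimately show "\<forall>k. m $ k = 0"
        using linear_mean_field_zero[of "\<lambda>k l. a $ l * \<alpha> $ k $ l" m] A_nonneg
        unfolding b_def by blast
    qed (simp add: sc_iff mean0)
    \<comment> \<open>The candidate state: a zero mean vector means zero tilt in every
      component.\<close>
    define \<nu> where "\<nu> k = gibbs_measure (U k) (\<epsilon> k) 0" for k
    have \<nu>_facts: "prob_space (\<nu> k)" "integrable (\<nu> k) (\<lambda>x. x ^ n)" "(\<integral>x. x \<partial>\<nu> k) = 0" for k n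
      unfolding \<nu>_def U_def using mean0[of k, unfolded U_def]
      by (simp_all only: prob_space_gibbs_measure integrable_power_gibbs_measure gibbs_measure_mean
          U_facts \<epsilon>_pos)
    have \<nu>_int: "integrable (\<nu> k) (\<lambda>x. x)" "integrable (\<nu> k) (\<lambda>x. x\<^sup>2)" for k
      using \<nu>_facts(2)[of k 1] \<nu>_facts(2)[of k 2] by simp_all
    have "stationary_state V F a \<sigma> \<nu>"
      unfolding stationary_state_def
    proof (intro conjI allI)
      fix k l x
      show "prob_space (\<nu> k)" by (rule \<nu>_facts)
      interpret prob_space "\<nu> l" by (rule \<nu>_facts)
      have "quadratic_interaction (\<alpha> $ k $ l) (x - y)
          = \<alpha> $ k $ l / 2 * x\<^sup>2 - \<alpha> $ k $ l * x * y + \<alpha> $ k $ l / 2 * y\<^sup>2" for y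
        by (simp add: quadratic_interaction_def power2_eq_square field_simps)
      then show "integrable (\<nu> l) (\<lambda>y. F k l (x - y))"
        using \<nu>_int by (simp add: F_eq)
      let ?Z = "\<integral>x. gibbs_weight (U k) (\<epsilon> k) 0 x \<partial>lborel"
      \<comment> \<open>The second moments of \<open>\<nu>\<close> put the factor \<open>?E\<close>
        in front of the weight; the normalization \<open>?Z * ?E\<close> cancels it.\<close>
      let ?E = "exp (- \<epsilon> k * (\<Sum>l\<in>UNIV. a $ l * \<alpha> $ k $ l / 2 * (\<integral>y. y\<^sup>2 \<partial>\<nu> l)))"
      have "?Z > 0"
        unfolding U_def by (intro integral_gibbs_weight_pos U_facts \<epsilon>_pos)
      then show "\<exists>Z>0. \<nu> k = density lborel (\<lambda>x. ennreal (1 / Z * exp (- (2 / (\<sigma> $ k) ^ 2) *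
           (V k x + (\<Sum>l\<in>UNIV. a $ l * conv (F k l) (\<nu> l) x)))))"
        unfolding stationary_exponent[of F \<alpha> V p \<theta> \<nu>, OF F_eq V_eq \<nu>_facts(1) \<nu>_int]
        by (intro exI[of _ "?Z * ?E"]) (simp add: \<nu>_facts(3) \<nu>_def[of k] gibbs_measure_def U_def b_def \<epsilon>_def)
    qed
    \<comment> \<open>The tilts of any stationary state come from its own means. These are
      self-consistent, hence zero, so the tilts vanish and the state is
      \<open>\<nu>\<close>.\<close>
    moreover have stat: "\<mu> = \<nu>" if st: "stationary_state V F a \<sigma> \<mu>" for \<mu>
    proof -
      note mom = stationary_state_moments[of V F a \<sigma> \<mu> \<alpha>, OF st F_eq \<alpha>_diag]
      define m where "m = (\<chi> k. \<integral>y. y \<partial>\<mu> k)"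
      have gibbs: "\<mu> k = gibbs_measure (U k) (\<epsilon> k) (?c m k)" for k
      proof -
        let ?E = "exp (- \<epsilon> k * (\<Sum>l\<in>UNIV. a $ l * \<alpha> $ k $ l / 2 * (\<integral>y. y\<^sup>2 \<partial>\<mu> l)))"
        obtain Z where Z: "Z > 0" and dens: "\<mu> k = density lborel (\<lambda>x. ennreal (1 / Z *
            exp (- (2 / (\<sigma> $ k) ^ 2) * (V k x + (\<Sum>l\<in>UNIV. a $ l * conv (F k l) (\<mu> l) x)))))"
          using st unfolding stationary_state_def by blast
        have dens': "\<mu> k = density lborel
            (\<lambda>x. ennreal (?E / Z * gibbs_weight (U k) (\<epsilon> k) (?c m k) x))"
          using dens unfolding stationary_exponent[of F \<alpha> V p \<theta> \<mu>, OF F_eq V_eq mom]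
          by (simp add: U_def b_def \<epsilon>_def m_def)
        show ?thesis
          unfolding dens' using Z mom(1)[of k, unfolded dens'] U_facts \<epsilon>_pos[of k]
          by (intro density_proportional_gibbs_weight) (auto simp: U_def)
      qed
      have "m $ k = ?mean k (?c m k)" for k
      proof -
        have "m $ k = (\<integral>y. y \<partial>\<mu> k)" by (simp add: m_def)
        also have "\<dots> = (\<integral>y. y \<partial>gibbs_measure (U k) (\<epsilon> k) (?c m k))" by (subst gibbs) (rule refl)
        also have "\<dots> = ?mean k (?c m k)"
          unfolding U_def by (intro gibbs_measure_mean U_facts \<epsilon>_pos)
        finally show ?thesis .
      qed
      then have "self_consistent V \<alpha> a \<sigma> m"
        unfolding sc_iff by (rule allI)
      then have "\<forall>k. m $ k = 0" by (simp add: sc)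
      then have "\<mu> k = \<nu> k" for k by (subst gibbs) (simp add: \<nu>_def)
      then show ?thesis by (rule ext)
    qed
    ultimately have "\<exists>!\<mu>. stationary_state V F a \<sigma> \<mu>" by blast
    moreover have "integrable (\<mu> k) (\<lambda>x. x) \<and> (\<integral>x. x \<partial>\<mu> k) = 0"
      if "stationary_state V F a \<sigma> \<mu>" for \<mu> k
      using \<nu>_int \<nu>_facts(3) by (simp add: stat[OF that])
    ultimately show "(\<forall>m. self_consistent V \<alpha> a \<sigma> m \<longleftrightarrow> (\<forall>k. m $ k = 0)) \<and>
             (\<exists>!\<mu>. stationary_state V F a \<sigma> \<mu>) \<and>
             (\<forall>\<mu>. stationary_state V F a \<sigma> \<mu> \<longrightarrow>
                (\<forall>k. integrable (\<mu> k) (\<lambda>x. x) \<and> (\<integral>x. x \<partial>\<mu> k) = 0))"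
      using sc by blast
  qed
qed

end
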